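(* Let $\mathfrak{g}$ be a Lie algebra with trivial center, and assume that $\mathrm{Der}(\mathfrak{g})$ is a complete Lie algebra. Then the derivation algebra of the full graph $\mathfrak{f}(\mathfrak{g})$ of $\mathfrak{g}$ is $\mathrm{Der}(\mathfrak{g})\times_{\varphi}F(\mathfrak{g})$. Therefore, $\mathfrak{f}(\mathfrak{g})$ is a complete Lie algebra if and only if $F(\mathfrak{g})=\mathfrak{g}$ (where $\mathfrak{g}$ is identified with $\mathrm{ad}(\mathfrak{g})\subseteq F(\mathfrak{g})$).
   Context: All Lie algebras are finite dimensional over a field of characteristic $0$. A Lie algebra is complete if its center is trivial and all its derivations are inner. Given a Lie algebra homomorphism $\varphi:\mathfrak{s}\to\mathrm{Der}(\mathfrak{g})$, $\mathfrak{s}\times_\varphi\mathfrak{g}$ is the vector space $\mathfrak{s}\oplus\mathfrak{g}$ with bracket $[(s_1,g_1),(s_2,g_2)]=([s_1,s_2],\,s_1(g_2)-s_2(g_1)+[g_1,g_2])$, where $s(g)=\varphi(s)(g)$. The full graph of $\mathfrak{g}$ is $\mathfrak{f}(\mathfrak{g})=\mathrm{Der}(\mathfrak{g})\times_{\mathrm{id}}\mathfrak{g}$, with the tautological action. $F(\mathfrak{g})=\{D\in\mathrm{Der}(\mathfrak{g}) : [D,D_1]\in\mathrm{ad}(\mathfrak{g})\ \forall D_1\in\mathrm{Der}(\mathfrak{g})\}$; it is a Lie subalgebra of $\mathrm{Der}(\mathfrak{g})$ containing $\mathrm{ad}(\mathfrak{g})$ as an ideal. In $\mathrm{Der}(\mathfrak{g})\times_\varphi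 F(\mathfrak{g})$ the action of $\mathrm{Der}(\mathfrak{g})$ on $F(\mathfrak{g})$ is by commutators: $s\cdot D=[s,D]$. An element $(s,D)\in\mathrm{Der}(\mathfrak{g})\times_\varphi F(\mathfrak{g})$ is regarded as the derivation of $\mathfrak{f}(\mathfrak{g})$ given by $(s_1,g)\mapsto([s,s_1],\,s(g)+D(g)+I([D,s_1]))$, where for an inner derivation $\mathrm{ad}(x)$ of the centerless algebra $\mathfrak{g}$, $I(\mathrm{ad}(x))=x$. *)

theory Defs
  imports Complex_Main "HOL-Library.Function_Algebras" "HOL-Library.Product_Plus"
begin

text \<open>
  A Lie algebra lives on a carrier inside an ambient type that supplies addition. Function types
  and products carry pointwise addition, so derivation algebras and semidirect products are again
  structures of the same kind.
\<close>

record ('k, 'a) lie_structure =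
  carrier :: "'a set"
  smult :: "'k \<Rightarrow> 'a \<Rightarrow> 'a"
  bracket :: "'a \<Rightarrow> 'a \<Rightarrow> 'a"

locale lie_algebra = vector_space "smult G"
  for G :: "('k::field_char_0, 'a::ab_group_add) lie_structure" +
  assumes subspace_carrier: "subspace (carrier G)"
    and finite_dim: "\<exists>B. finite B \<and> span B = carrier G"
    and bracket_closed: "\<lbrakk>x \<in> carrier G; y \<in> carrier G\<rbrakk> \<Longrightarrow> bracket G x y \<in> carrier G"
    and bracket_add_left: "\<lbrakk>x \<in> carrier G; y \<in> carrier G; z \<in> carrier G\<rbrakk> \<Longrightarrow>
      bracket G (x + y) z = bracket G x z + bracket G y z"
    and bracket_add_right: "\<lbrakk>x \<in> carrier G; y \<in> carrier G; z \<in> carrier G\<rbrakk> \<Longrightarrow>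
      bracket G x (y + z) = bracket G x y + bracket G x z"
    and bracket_smult_left: "\<lbrakk>x \<in> carrier G; y \<in> carrier G\<rbrakk> \<Longrightarrow>
      bracket G (smult G c x) y = smult G c (bracket G x y)"
    and bracket_smult_right: "\<lbrakk>x \<in> carrier G; y \<in> carrier G\<rbrakk> \<Longrightarrow>
      bracket G x (smult G c y) = smult G c (bracket G x y)"
    and bracket_self: "x \<in> carrier G \<Longrightarrow> bracket G x x = 0"
    and jacobi: "\<lbrakk>x \<in> carrier G; y \<in> carrier G; z \<in> carrier G\<rbrakk> \<Longrightarrow>
      bracket G x (bracket G y z) + bracket G y (bracket G z x) + bracket G z (bracket G x y) = 0"

definition center :: "('k, 'a::ab_group_add) lie_structure \<Rightarrow> 'a set" where
  "center G = {x \<in> carrier G. \<forall>y\<in>carrier G. bracket G x y = 0}"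

text \<open>
  Maps on the carrier are represented by functions vanishing outside it: this makes the
  representation unique and is preserved by pointwise operations and by commutators.
\<close>

definition derivations :: "('k, 'a::ab_group_add) lie_structure \<Rightarrow> ('a \<Rightarrow> 'a) set" where
  "derivations G = {D.
     (\<forall>x. x \<notin> carrier G \<longrightarrow> D x = 0) \<and>
     (\<forall>x\<in>carrier G. D x \<in> carrier G) \<and>
     (\<forall>x\<in>carrier G. \<forall>y\<in>carrier G. D (x + y) = D x + D y) \<and>
     (\<forall>c. \<forall>x\<in>carrier G. D (smult G c x) = smult G c (D x)) \<and>
     (\<forall>x\<in>carrier G. \<forall>y\<in>carrier G.
        D (bracket G x y) = bracket G (D x) y + bracket G x (D y))}"

definition ad :: "('k, 'a::ab_group_add) lie_structure \<Rightarrow> 'a \<Rightarrow> 'a \<Rightarrow> 'a" where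
  "ad G x = (\<lambda>y. if y \<in> carrier G then bracket G x y else 0)"

definition Der :: "('k, 'a::ab_group_add) lie_structure \<Rightarrow> ('k, 'a \<Rightarrow> 'a) lie_structure" where
  "Der G = \<lparr>carrier = derivations G,
            smult = (\<lambda>c D x. smult G c (D x)),
            bracket = (\<lambda>D E x. D (E x) - E (D x))\<rparr>"

locale complete_lie_algebra = lie_algebra +
  assumes center_trivial: "center G = {0}"
    and derivations_inner: "D \<in> derivations G \<Longrightarrow> \<exists>x\<in>carrier G. D = ad G x"

locale lie_isomorphism = source: lie_algebra G + target: lie_algebra H
  for G :: "('k::field_char_0, 'a::ab_group_add) lie_structure"
    and H :: "('k, 'b::ab_group_add) lie_structure" +
  fixes f :: "'a \<Rightarrow> 'b"
  assumes bij: "bij_betw f (carrier G) (carrier H)"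
    and hom_add: "\<lbrakk>x \<in> carrier G; y \<in> carrier G\<rbrakk> \<Longrightarrow> f (x + y) = f x + f y"
    and hom_smult: "x \<in> carrier G \<Longrightarrow> f (smult G c x) = smult H c (f x)"
    and hom_bracket: "\<lbrakk>x \<in> carrier G; y \<in> carrier G\<rbrakk> \<Longrightarrow>
      f (bracket G x y) = bracket H (f x) (f y)"

text \<open>
  Intended for an action \<open>\<phi>\<close> that is a Lie algebra homomorphism from \<open>S\<close> to \<open>Der G\<close>.
\<close>

definition semidirect ::
  "('k, 's::ab_group_add) lie_structure \<Rightarrow> ('s \<Rightarrow> 'a \<Rightarrow> 'a) \<Rightarrow>
   ('k, 'a::ab_group_add) lie_structure \<Rightarrow> ('k, 's \<times> 'a) lie_structure" where
  "semidirect S \<phi> G =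
     \<lparr>carrier = carrier S \<times> carrier G,
      smult = (\<lambda>c (s, g). (smult S c s, smult G c g)),
      bracket = (\<lambda>(s1, g1) (s2, g2).
        (bracket S s1 s2, \<phi> s1 g2 - \<phi> s2 g1 + bracket G g1 g2))\<rparr>"

definition full_graph ::
  "('k, 'a::ab_group_add) lie_structure \<Rightarrow> ('k, ('a \<Rightarrow> 'a) \<times> 'a) lie_structure" where
  "full_graph G = semidirect (Der G) (\<lambda>s. s) G"

definition F :: "('k, 'a::ab_group_add) lie_structure \<Rightarrow> ('a \<Rightarrow> 'a) set" where
  "F G = {D \<in> derivations G. \<forall>E\<in>derivations G. bracket (Der G) D E \<in> ad G ` carrier G}"

definition F_algebra ::
  "('k, 'a::ab_group_add) lie_structure \<Rightarrow> ('k, 'a \<Rightarrow> 'a) lie_structure" where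
  "F_algebra G = (Der G)\<lparr>carrier := F G\<rparr>"

definition F_action ::
  "('k, 'a::ab_group_add) lie_structure \<Rightarrow> ('a \<Rightarrow> 'a) \<Rightarrow> ('a \<Rightarrow> 'a) \<Rightarrow> ('a \<Rightarrow> 'a)" where
  "F_action G s = (\<lambda>D. if D \<in> F G then bracket (Der G) s D else 0)"

text \<open>
  The preimage of an inner derivation; it is determined only when the center is trivial.
\<close>

definition inner_preimage :: "('k, 'a::ab_group_add) lie_structure \<Rightarrow> ('a \<Rightarrow> 'a) \<Rightarrow> 'a" where
  "inner_preimage G = the_inv_into (carrier G) (ad G)"

definition graph_derivation ::
  "('k, 'a::ab_group_add) lie_structure \<Rightarrow> ('a \<Rightarrow> 'a) \<times> ('a \<Rightarrow> 'a) \<Rightarrow>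
   ('a \<Rightarrow> 'a) \<times> 'a \<Rightarrow> ('a \<Rightarrow> 'a) \<times> 'a" where
  "graph_derivation G = (\<lambda>(s, D) (s1, g).
     if (s1, g) \<in> carrier (full_graph G)
     then (bracket (Der G) s s1, s g + D g + inner_preimage G (bracket (Der G) D s1))
     else 0)"

end

theory Submission imports Defs begin

text \<open>
  Write \<open>L = Der(G)\<close>, \<open>f = L \<times> G\<close> for the full graph and \<open>M = L \<times> F(G)\<close> for the candidate
  derivation algebra. Since \<open>G\<close> has trivial center, \<open>\<iota>(s, x) = (s, ad x)\<close> embeds \<open>f\<close> into \<open>M\<close>. The image is
  an ideal: for \<open>D\<close> in \<open>F(G)\<close> every commutator \<open>[D, s]\<close> is inner by definition of \<open>F\<close>. The derivation of
  \<open>f\<close> attached to \<open>u\<close> in \<open>M\<close> is nothing but \<open>ad u\<close> restricted to this ideal and pulled back along \<open>\<iota>\<close>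
  (\<open>embedding_graph_derivation\<close>). That it is a derivation, and that it depends on \<open>u\<close> as a Lie algebra
  homomorphism, are therefore two readings of the Jacobi identity in \<open>M\<close>.

  The map is injective because \<open>L\<close> has trivial center. For surjectivity
  (\<open>derivation_of_full_graph_is_graph_derivation\<close>), split a derivation \<open>E\<close> of \<open>f\<close> as
  \<open>E(s, g) = (a s + c g, b s + d g)\<close>. Triviality of the center of \<open>G\<close> forces \<open>c = 0\<close>. Then \<open>a\<close> and \<open>d\<close>
  are derivations of \<open>L\<close> and \<open>G\<close>; completeness of \<open>L\<close> gives \<open>a = ad s0\<close>. Applying \<open>E\<close> to
  \<open>[(s, 0), (0, g)] = (0, s g)\<close> yields \<open>[d - s0, s] = ad (b s)\<close>, so \<open>D = d - s0\<close> lies in \<open>F(G)\<close> and \<open>E\<close> is the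
  derivation attached to \<open>(s0, D)\<close>.

  Finally, the inner derivations of \<open>f\<close> are those attached to the elements of \<open>\<iota>(f)\<close>, and \<open>f\<close> has trivial
  center. Hence \<open>f\<close> is complete exactly when \<open>\<iota>\<close> is onto \<open>M\<close>, that is, when \<open>F(G) = ad(G)\<close>.
\<close>

section \<open>Calculus in a Lie algebra\<close>

context lie_algebra
begin

lemma carrier_closed [simp, intro]:
  "0 \<in> carrier G"
  "\<lbrakk>x \<in> carrier G; y \<in> carrier G\<rbrakk> \<Longrightarrow> x + y \<in> carrier G"
  "\<lbrakk>x \<in> carrier G; y \<in> carrier G\<rbrakk> \<Longrightarrow> x - y \<in> carrier G"
  "x \<in> carrier G \<Longrightarrow> - x \<in> carrier G"
  "x \<in> carrier G \<Longrightarrow> smult G c x \<in> carrier G"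
  "\<lbrakk>x \<in> carrier G; y \<in> carrier G\<rbrakk> \<Longrightarrow> bracket G x y \<in> carrier G"
  using subspace_carrier bracket_closed
  by (auto intro: subspace_0 subspace_add subspace_diff subspace_neg subspace_scale)

lemma bracket_zero [simp]:
  assumes "x \<in> carrier G"
  shows "bracket G 0 x = 0" "bracket G x 0 = 0"
  using bracket_add_left[of 0 0 x] bracket_add_right[of x 0 0] assms by auto

lemma bracket_minus:
  assumes "x \<in> carrier G" "y \<in> carrier G"
  shows "bracket G (- x) y = - bracket G x y" "bracket G x (- y) = - bracket G x y"
  using bracket_add_left[of x "- x" y] bracket_add_right[of x y "- y"] assms
  by (auto simp: eq_neg_iff_add_eq_0 add.commute)

lemma bracket_diff:
  assumes "x \<in> carrier G" "y \<in> carrier G" "z \<in> carrier G"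
  shows "bracket G (x - y) z = bracket G x z - bracket G y z"
    and "bracket G z (x - y) = bracket G z x - bracket G z y"
  using bracket_add_left[of x "- y" z] bracket_add_right[of z x "- y"] assms
  by (auto simp: bracket_minus)

lemma bracket_skew:
  assumes "x \<in> carrier G" "y \<in> carrier G"
  shows "bracket G x y = - bracket G y x"
proof -
  have "bracket G (x + y) (x + y) = bracket G x y + bracket G y x"
    using assms
    by (simp add: bracket_add_left bracket_add_right bracket_self[of x] bracket_self[of y])
  moreover have "bracket G (x + y) (x + y) = 0" using assms by (simp add: bracket_self)
  ultimately show ?thesis by (metis eq_neg_iff_add_eq_0)
qed

text \<open>
  In this form the Jacobi identity rewrites a bracket of brackets without cyclic permutations, and it
  serves both for derivations acting on brackets and for brackets of derivations.
\<close>

lemma bracket_leibniz: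
  assumes "x \<in> carrier G" "y \<in> carrier G" "z \<in> carrier G"
  shows "bracket G x (bracket G y z) = bracket G (bracket G x y) z + bracket G y (bracket G x z)"
proof -
  have "bracket G y (bracket G z x) = - bracket G y (bracket G x z)"
    using assms by (simp add: bracket_skew[of z x] bracket_minus)
  moreover have "bracket G z (bracket G x y) = - bracket G (bracket G x y) z"
    using assms by (simp add: bracket_skew[of z])
  ultimately show ?thesis using jacobi[OF assms] by (simp add: algebra_simps)
qed

end

lemma derivationsD:
  assumes "D \<in> derivations G"
  shows "x \<notin> carrier G \<Longrightarrow> D x = 0"
    and "x \<in> carrier G \<Longrightarrow> D x \<in> carrier G"
    and "\<lbrakk>x \<in> carrier G; y \<in> carrier G\<rbrakk> \<Longrightarrow> D (x + y) = D x + D y"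
    and "x \<in> carrier G \<Longrightarrow> D (smult G c x) = smult G c (D x)"
    and "\<lbrakk>x \<in> carrier G; y \<in> carrier G\<rbrakk> \<Longrightarrow>
      D (bracket G x y) = bracket G (D x) y + bracket G x (D y)"
  using assms by (auto simp: derivations_def)

lemma carrier_Der [simp]: "carrier (Der G) = derivations G"
  by (simp add: Der_def)

lemma Der_apply [simp]:
  "smult (Der G) c D x = smult G c (D x)"
  "bracket (Der G) D E x = D (E x) - E (D x)"
  by (simp_all add: Der_def)

context lie_algebra
begin

lemma derivation_zero: "D \<in> derivations G \<Longrightarrow> D 0 = 0"
  using derivationsD(3)[of D G 0 0] by auto

lemma derivation_diff:
  assumes "D \<in> derivations G" "x \<in> carrier G" "y \<in> carrier G"
  shows "D (x - y) = D x - D y"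
  using derivationsD(3)[of D G "x - y" y] assms by auto

lemma ad_apply [simp]: "y \<in> carrier G \<Longrightarrow> ad G x y = bracket G x y"
  by (simp add: ad_def)

lemma ad_in_derivations:
  assumes "x \<in> carrier G"
  shows "ad G x \<in> derivations G"
  using assms
  by (auto simp: derivations_def ad_def bracket_add_right bracket_smult_right bracket_leibniz[OF assms])

lemma ad_add:
  assumes "x \<in> carrier G" "y \<in> carrier G"
  shows "ad G (x + y) = ad G x + ad G y"
  using assms by (intro ext) (simp add: ad_def bracket_add_left)

lemma ad_smult:
  assumes "x \<in> carrier G"
  shows "ad G (smult G c x) = smult (Der G) c (ad G x)"
  using assms by (intro ext) (simp add: ad_def bracket_smult_left)

lemma ad_uminus:
  assumes "x \<in> carrier G"
  shows "ad G (- x) = - ad G x"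
  using assms by (intro ext) (simp add: ad_def bracket_minus)

lemma ad_diff:
  assumes "x \<in> carrier G" "y \<in> carrier G"
  shows "ad G (x - y) = ad G x - ad G y"
  using assms by (intro ext) (simp add: ad_def bracket_diff)

lemma bracket_derivation_ad:
  assumes "D \<in> derivations G" "x \<in> carrier G"
  shows "bracket (Der G) D (ad G x) = ad G (D x)"
  using assms by (intro ext) (simp add: ad_def derivationsD derivation_zero)

lemma inj_on_ad:
  assumes "center G = {0}"
  shows "inj_on (ad G) (carrier G)"
proof (rule inj_onI)
  fix x y assume xy: "x \<in> carrier G" "y \<in> carrier G" and eq: "ad G x = ad G y"
  have "bracket G (x - y) z = 0" if "z \<in> carrier G" for z
    using fun_cong[OF eq, of z] that xy by (simp add: bracket_diff)
  then have "x - y \<in> center G" using xy by (auto simp: center_def)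
  then show "x = y" using assms by simp
qed

end


section \<open>Constructions of Lie algebras\<close>

context lie_algebra
begin

text \<open>
  The map is linear on the carrier only, so the results on linear maps defined on the whole ambient
  type do not apply.
\<close>

lemma image_of_span:
  assumes H: "vector_space sH"
    and add: "\<And>x y. \<lbrakk>x \<in> carrier G; y \<in> carrier G\<rbrakk> \<Longrightarrow> f (x + y) = f x + f y"
    and scale: "\<And>c x. x \<in> carrier G \<Longrightarrow> f (smult G c x) = sH c (f x)"
    and B: "span B = carrier G"
    and x: "x \<in> carrier G"
  shows "f x \<in> module.span sH (f ` B)"
proof -
  interpret H: vector_space sH by (rule H)
  have BG: "B \<subseteq> carrier G" using B span_superset[of B] by simp
  have f0: "f 0 = 0" using add[of 0 0] by auto
  have "x \<in> carrier G \<and> f x \<in> H.span (f ` B)" if "x \<in> span B" for x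
    using that
  proof (induction rule: span_induct_alt)
    case base
    then show ?case by (simp add: f0 H.span_zero)
  next
    case (step c y z)
    then have "y \<in> carrier G" "f y \<in> H.span (f ` B)"
      using BG by (blast intro: H.span_base)+
    with step show ?case by (simp add: add scale H.span_add H.span_scale)
  qed
  then show ?thesis using B x by simp
qed

lemma subalgebra:
  assumes "subspace H" "H \<subseteq> carrier G"
    and "\<And>x y. \<lbrakk>x \<in> H; y \<in> H\<rbrakk> \<Longrightarrow> bracket G x y \<in> H"
  shows "lie_algebra (G\<lparr>carrier := H\<rparr>)"
proof -
  obtain B where B: "finite B" "span B = carrier G" using finite_dim by blast
  obtain C where C: "C \<subseteq> H" "independent C" "H \<subseteq> span C"
    using maximal_independent_subset by blast
  have "C \<subseteq> span B" using C(1) assms(2) B(2) by simp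
  then have "finite C" using independent_span_bound[OF B(1) C(2)] by simp
  moreover have "span C = H" using C(3) span_minimal[OF C(1) assms(1)] by simp
  ultimately have fin: "\<exists>C. finite C \<and> span C = H" by metis
  have sub: "x \<in> carrier G" if "x \<in> H" for x using that assms(2) by blast
  show ?thesis
    by (intro lie_algebra.intro lie_algebra_axioms.intro)
      (simp_all add: vector_space_axioms fin sub assms(1,3) bracket_add_left bracket_add_right
        bracket_smult_left bracket_smult_right bracket_self jacobi)
qed

text \<open>
  Every axiom of a Lie algebra passes to the image, finite dimension included. This is how the
  derivation algebra of the full graph is seen to be a finite-dimensional Lie algebra: it is a copy of
  a semidirect product already known to be one.
\<close>

lemma isomorphism_onto_image:
  assumes H: "vector_space (smult H)"
    and bij: "bij_betw f (carrier G) (carrier H)"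
    and add: "\<And>x y. \<lbrakk>x \<in> carrier G; y \<in> carrier G\<rbrakk> \<Longrightarrow> f (x + y) = f x + f y"
    and scale: "\<And>c x. x \<in> carrier G \<Longrightarrow> f (smult G c x) = smult H c (f x)"
    and br: "\<And>x y. \<lbrakk>x \<in> carrier G; y \<in> carrier G\<rbrakk> \<Longrightarrow>
      f (bracket G x y) = bracket H (f x) (f y)"
  shows "lie_isomorphism G H f"
proof -
  interpret H: vector_space "smult H" by (rule H)
  have im: "carrier H = f ` carrier G" using bij by (simp add: bij_betw_def)
  have f0: "f 0 = 0" using add[of 0 0] by auto
  have sub: "H.subspace (carrier H)"
    unfolding H.subspace_def im
  proof (intro conjI ballI allI)
    show "0 \<in> f ` carrier G" using f0 by (metis carrier_closed(1) imageI)
  qed (auto simp: add[symmetric] scale[symmetric])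
  obtain B where B: "finite B" "span B = carrier G" using finite_dim by blast
  have "B \<subseteq> carrier G" using B(2) span_superset[of B] by simp
  moreover have "f x \<in> H.span (f ` B)" if "x \<in> carrier G" for x
    using that by (intro image_of_span[where sH = "smult H"] H add scale B(2))
  ultimately have "H.span (f ` B) = carrier H"
    using sub by (intro equalityI H.span_minimal) (auto simp: im)
  then have fin: "\<exists>B. finite B \<and> H.span B = carrier H" using B(1) by blast
  note collect = add[symmetric] scale[symmetric] br[symmetric]
  have "lie_algebra H"
  proof (intro lie_algebra.intro lie_algebra_axioms.intro H sub fin; unfold im; elim imageE)
  qed (simp_all add: collect bracket_add_left bracket_add_right bracket_smult_left
      bracket_smult_right bracket_self jacobi f0)
  then show ?thesis
    using lie_algebra_axioms bij add scale br
    by (simp add: lie_isomorphism_def lie_isomorphism_axioms_def)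
qed

end

lemma semidirect_simps [simp]:
  "carrier (semidirect S \<phi> G) = carrier S \<times> carrier G"
  "smult (semidirect S \<phi> G) c (s, g) = (smult S c s, smult G c g)"
  "bracket (semidirect S \<phi> G) (s1, g1) (s2, g2) =
     (bracket S s1 s2, \<phi> s1 g2 - \<phi> s2 g1 + bracket G g1 g2)"
  by (auto simp: semidirect_def)

lemma lie_algebra_semidirect:
  fixes S :: "('k::field_char_0, 's::ab_group_add) lie_structure"
    and G :: "('k, 'a::ab_group_add) lie_structure"
  assumes S: "lie_algebra S" and G: "lie_algebra G"
    and der: "\<And>s. s \<in> carrier S \<Longrightarrow> \<phi> s \<in> derivations G"
    and add: "\<And>s t g. \<lbrakk>s \<in> carrier S; t \<in> carrier S; g \<in> carrier G\<rbrakk> \<Longrightarrow>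
      \<phi> (s + t) g = \<phi> s g + \<phi> t g"
    and scale: "\<And>c s g. \<lbrakk>s \<in> carrier S; g \<in> carrier G\<rbrakk> \<Longrightarrow>
      \<phi> (smult S c s) g = smult G c (\<phi> s g)"
    and br: "\<And>s t g. \<lbrakk>s \<in> carrier S; t \<in> carrier S; g \<in> carrier G\<rbrakk> \<Longrightarrow>
      \<phi> (bracket S s t) g = \<phi> s (\<phi> t g) - \<phi> t (\<phi> s g)"
  shows "lie_algebra (semidirect S \<phi> G)"
proof -
  interpret S: lie_algebra S by (rule S)
  interpret G: lie_algebra G by (rule G)
  let ?M = "semidirect S \<phi> G"
  interpret M: vector_space "smult ?M"
    by unfold_locales (auto simp: S.scale_right_distrib S.scale_left_distrib
        G.scale_right_distrib G.scale_left_distrib)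
  note act = derivationsD[OF der] G.derivation_zero[OF der] G.derivation_diff[OF der]
  have sub: "M.subspace (carrier ?M)"
    by (auto simp: M.subspace_def zero_prod_def)
  obtain B where B: "finite B" "S.span B = carrier S" using S.finite_dim by blast
  obtain C where C: "finite C" "G.span C = carrier G" using G.finite_dim by blast
  let ?B = "(\<lambda>s. (s, 0)) ` B \<union> (\<lambda>g. (0, g)) ` C"
  have "M.span ?B = carrier ?M"
  proof (intro equalityI M.span_minimal sub)
    show "?B \<subseteq> carrier ?M"
      using B(2) C(2) S.span_superset[of B] G.span_superset[of C] by auto
    show "carrier ?M \<subseteq> M.span ?B"
    proof clarsimp
      fix s g assume "s \<in> carrier S" "g \<in> carrier G"
      then have "(s, 0) \<in> M.span ((\<lambda>s. (s, 0)) ` B)" "(0, g) \<in> M.span ((\<lambda>g. (0, g)) ` C)"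
        by (auto intro!: S.image_of_span[OF M.vector_space_axioms _ _ B(2)]
            G.image_of_span[OF M.vector_space_axioms _ _ C(2)])
      then have "(s, 0) + (0, g) \<in> M.span ?B"
        by (meson M.span_add M.span_mono Un_upper1 Un_upper2 subsetD)
      then show "(s, g) \<in> M.span ?B" by simp
    qed
  qed
  moreover have "finite ?B" using B C by simp
  ultimately have fin: "\<exists>B. finite B \<and> M.span B = carrier ?M" by blast
  have jac: "bracket ?M x (bracket ?M y z) + bracket ?M y (bracket ?M z x)
      + bracket ?M z (bracket ?M x y) = 0"
    if "x \<in> carrier ?M" "y \<in> carrier ?M" "z \<in> carrier ?M" for x y z
  proof -
    obtain s1 g1 s2 g2 s3 g3 where eq: "x = (s1, g1)" "y = (s2, g2)" "z = (s3, g3)"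
      by (metis surj_pair)
    have mem: "s1 \<in> carrier S" "s2 \<in> carrier S" "s3 \<in> carrier S"
      "g1 \<in> carrier G" "g2 \<in> carrier G" "g3 \<in> carrier G" using that eq by auto
    (* The mixed terms cancel in pairs once every one of them has the action on the left. *)
    have skew: "bracket G g (\<phi> s h) = - bracket G (\<phi> s h) g"
      if "g \<in> carrier G" "h \<in> carrier G" "s \<in> carrier S" for g h s
      using that by (intro G.bracket_skew) (auto simp: act)
    have "\<phi> s1 (\<phi> s2 g3 - \<phi> s3 g2 + bracket G g2 g3) - \<phi> (bracket S s2 s3) g1
        + bracket G g1 (\<phi> s2 g3 - \<phi> s3 g2 + bracket G g2 g3)
      + (\<phi> s2 (\<phi> s3 g1 - \<phi> s1 g3 + bracket G g3 g1) - \<phi> (bracket S s3 s1) g2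
        + bracket G g2 (\<phi> s3 g1 - \<phi> s1 g3 + bracket G g3 g1))
      + (\<phi> s3 (\<phi> s1 g2 - \<phi> s2 g1 + bracket G g1 g2) - \<phi> (bracket S s1 s2) g3
        + bracket G g3 (\<phi> s1 g2 - \<phi> s2 g1 + bracket G g1 g2))
      = bracket G g1 (bracket G g2 g3) + bracket G g2 (bracket G g3 g1)
        + bracket G g3 (bracket G g1 g2)"
      using mem
      by (simp add: act br G.bracket_add_right G.bracket_diff)
        (simp add: mem skew algebra_simps)
    then show ?thesis
      using mem S.jacobi[of s1 s2 s3] G.jacobi[of g1 g2 g3]
      by (simp add: eq zero_prod_def)
  qed
  show ?thesis
  proof (intro lie_algebra.intro lie_algebra_axioms.intro M.vector_space_axioms sub fin jac)
    fix x y and c :: 'k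
    assume "x \<in> carrier ?M" "y \<in> carrier ?M"
    then obtain s1 g1 s2 g2 where eq: "x = (s1, g1)" "y = (s2, g2)"
      and mem: "s1 \<in> carrier S" "s2 \<in> carrier S" "g1 \<in> carrier G" "g2 \<in> carrier G"
      by auto
    show "bracket ?M x y \<in> carrier ?M"
      using mem by (simp add: eq act)
    show "bracket ?M (smult ?M c x) y = smult ?M c (bracket ?M x y)"
      using mem
      by (simp add: eq act scale S.bracket_smult_left G.bracket_smult_left
          G.scale_right_distrib G.scale_right_diff_distrib)
    show "bracket ?M x (smult ?M c y) = smult ?M c (bracket ?M x y)"
      using mem
      by (simp add: eq act scale S.bracket_smult_right G.bracket_smult_right
          G.scale_right_distrib G.scale_right_diff_distrib)
  next
    fix x y z
    assume "x \<in> carrier ?M" "y \<in> carrier ?M" "z \<in> carrier ?M"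
    then obtain s1 g1 s2 g2 s3 g3 where eq: "x = (s1, g1)" "y = (s2, g2)" "z = (s3, g3)"
      and mem: "s1 \<in> carrier S" "s2 \<in> carrier S" "s3 \<in> carrier S"
        "g1 \<in> carrier G" "g2 \<in> carrier G" "g3 \<in> carrier G"
      by auto
    show "bracket ?M (x + y) z = bracket ?M x z + bracket ?M y z"
      using mem
      by (simp add: eq act add S.bracket_add_left G.bracket_add_left algebra_simps)
    show "bracket ?M x (y + z) = bracket ?M x y + bracket ?M x z"
      using mem
      by (simp add: eq act add S.bracket_add_right G.bracket_add_right algebra_simps)
  qed (clarsimp simp: S.bracket_self G.bracket_self zero_prod_def)+
qed



section \<open>The semidirect product of derivations and almost inner derivations\<close>

abbreviation graph_extension ::
  "('k, 'a::ab_group_add) lie_structure \<Rightarrow> ('k, ('a \<Rightarrow> 'a) \<times> ('a \<Rightarrow> 'a)) lie_structure" where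
  "graph_extension G \<equiv> semidirect (Der G) (F_action G) (F_algebra G)"

definition graph_embedding ::
  "('k, 'a::ab_group_add) lie_structure \<Rightarrow> ('a \<Rightarrow> 'a) \<times> 'a \<Rightarrow> ('a \<Rightarrow> 'a) \<times> ('a \<Rightarrow> 'a)" where
  "graph_embedding G = (\<lambda>(s, x). (s, ad G x))"

lemma graph_embedding_apply [simp]: "graph_embedding G (s, x) = (s, ad G x)"
  by (simp add: graph_embedding_def)

lemma full_graph_simps [simp]:
  "carrier (full_graph G) = derivations G \<times> carrier G"
  "smult (full_graph G) c (s, g) = (smult (Der G) c s, smult G c g)"
  "bracket (full_graph G) (s1, g1) (s2, g2) =
     (bracket (Der G) s1 s2, s1 g2 - s2 g1 + bracket G g1 g2)"
  by (auto simp: full_graph_def)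

lemma F_algebra_simps [simp]:
  "carrier (F_algebra G) = F G"
  "smult (F_algebra G) = smult (Der G)"
  "bracket (F_algebra G) = bracket (Der G)"
  by (auto simp: F_algebra_def)

lemma graph_derivation_apply:
  assumes "s1 \<in> derivations G" "g \<in> carrier G"
  shows "graph_derivation G (s, D) (s1, g) =
    (bracket (Der G) s s1, s g + D g + inner_preimage G (bracket (Der G) D s1))"
  using assms by (simp add: graph_derivation_def)

lemma graph_derivation_outside:
  "v \<notin> carrier (full_graph G) \<Longrightarrow> graph_derivation G u v = 0"
  by (auto simp: graph_derivation_def split: prod.splits)

locale centerless_lie_algebra_with_complete_Der =
  lie_algebra G + D: complete_lie_algebra "Der G"
  for G :: "('k::field_char_0, 'a::ab_group_add) lie_structure" +
  assumes centerless: "center G = {0}"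
begin

lemmas derivations_closed [simp, intro] = D.carrier_closed[unfolded carrier_Der]

lemma ad_eq_iff:
  "\<lbrakk>x \<in> carrier G; y \<in> carrier G\<rbrakk> \<Longrightarrow> ad G x = ad G y \<longleftrightarrow> x = y"
  using inj_on_ad[OF centerless] by (auto simp: inj_on_def)

lemma inner_preimage_ad [simp]: "x \<in> carrier G \<Longrightarrow> inner_preimage G (ad G x) = x"
  unfolding inner_preimage_def by (rule the_inv_into_f_f[OF inj_on_ad[OF centerless]])

lemma Der_bracket_skew:
  "\<lbrakk>s \<in> derivations G; t \<in> derivations G\<rbrakk> \<Longrightarrow> bracket (Der G) s t = - bracket (Der G) t s"
  by (rule D.bracket_skew[unfolded carrier_Der])

lemma F_derivation: "D \<in> F G \<Longrightarrow> D \<in> derivations G"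
  by (simp add: F_def)

text \<open>
  The inverse image under \<open>ad\<close> is an arbitrary value outside the inner derivations; membership in \<open>F\<close> is
  what makes it meaningful in the formula for graph derivations.
\<close>

lemma inner_preimage_F:
  assumes "D \<in> F G" "s \<in> derivations G"
  shows "inner_preimage G (bracket (Der G) D s) \<in> carrier G"
    and "ad G (inner_preimage G (bracket (Der G) D s)) = bracket (Der G) D s"
proof -
  obtain x where "x \<in> carrier G" "bracket (Der G) D s = ad G x"
    using assms by (auto simp: F_def)
  then show "inner_preimage G (bracket (Der G) D s) \<in> carrier G"
    "ad G (inner_preimage G (bracket (Der G) D s)) = bracket (Der G) D s"
    by simp_all
qed

lemma ad_in_F:
  assumes "x \<in> carrier G"
  shows "ad G x \<in> F G"
proof -
  have "bracket (Der G) (ad G x) E \<in> ad G ` carrier G" if "E \<in> derivations G" for E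
  proof -
    have "bracket (Der G) (ad G x) E = - bracket (Der G) E (ad G x)"
      using assms that by (intro Der_bracket_skew ad_in_derivations)
    also have "\<dots> = ad G (- E x)"
      using assms that by (simp add: bracket_derivation_ad ad_uminus derivationsD)
    finally show ?thesis using assms that by (simp add: derivationsD)
  qed
  then show ?thesis using assms by (simp add: F_def ad_in_derivations)
qed

text \<open>
  The bracket is even inner, up to the sign from skew symmetry, and inner derivations lie in \<open>F\<close>.
\<close>

lemma bracket_in_F:
  assumes "s \<in> derivations G" "D \<in> F G"
  shows "bracket (Der G) s D \<in> F G"
proof -
  let ?x = "inner_preimage G (bracket (Der G) D s)"
  have "bracket (Der G) s D = ad G (- ?x)"
    using assms inner_preimage_F Der_bracket_skew[of s D]
    by (simp add: ad_uminus F_derivation)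
  then show ?thesis using assms inner_preimage_F by (simp add: ad_in_F)
qed

lemma F_subspace: "D.subspace (F G)"
  unfolding D.subspace_def
proof (intro conjI ballI allI)
  show "0 \<in> F G" using ad_in_F[of 0] by (simp add: ad_def zero_fun_def cong: if_cong)
next
  fix D E assume DE: "D \<in> F G" "E \<in> F G"
  have "bracket (Der G) (D + E) s \<in> ad G ` carrier G" if s: "s \<in> derivations G" for s
  proof -
    have "bracket (Der G) (D + E) s = bracket (Der G) D s + bracket (Der G) E s"
      using DE s D.bracket_add_left by (simp add: F_derivation)
    also have "\<dots> = ad G (inner_preimage G (bracket (Der G) D s)
        + inner_preimage G (bracket (Der G) E s))"
      using DE s by (simp add: ad_add inner_preimage_F)
    finally show ?thesis using DE s inner_preimage_F by simp
  qed
  then show "D + E \<in> F G" using DE by (simp add: F_def)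
next
  fix c D assume D: "D \<in> F G"
  have "bracket (Der G) (smult (Der G) c D) s \<in> ad G ` carrier G"
    if s: "s \<in> derivations G" for s
  proof -
    have "bracket (Der G) (smult (Der G) c D) s = smult (Der G) c (bracket (Der G) D s)"
      using D s D.bracket_smult_left by (simp add: F_derivation)
    also have "\<dots> = ad G (smult G c (inner_preimage G (bracket (Der G) D s)))"
      using D s by (simp add: ad_smult inner_preimage_F)
    finally show ?thesis using D s inner_preimage_F by simp
  qed
  then show "smult (Der G) c D \<in> F G" using D by (simp add: F_def)
qed

lemma lie_algebra_F: "lie_algebra (F_algebra G)"
  unfolding F_algebra_def
  by (rule D.subalgebra[OF F_subspace]) (auto simp: F_derivation intro: bracket_in_F)

lemma lie_algebra_full_graph: "lie_algebra (full_graph G)"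
  unfolding full_graph_def
  by (rule lie_algebra_semidirect[OF D.lie_algebra_axioms lie_algebra_axioms]) simp_all

lemma F_closed [simp]:
  "0 \<in> F G"
  "\<lbrakk>D \<in> F G; E \<in> F G\<rbrakk> \<Longrightarrow> D + E \<in> F G"
  "D \<in> F G \<Longrightarrow> smult (Der G) c D \<in> F G"
  using F_subspace by (auto simp: D.subspace_def)

lemma F_action_apply: "D \<in> F G \<Longrightarrow> F_action G s D = bracket (Der G) s D"
  by (simp add: F_action_def)

lemma F_action_derivation:
  assumes "s \<in> derivations G"
  shows "F_action G s \<in> derivations (F_algebra G)"
  using assms
  by (auto simp: derivations_def[of "F_algebra G"] F_action_def bracket_in_F F_derivation
      D.bracket_add_right D.bracket_smult_right D.bracket_leibniz[of s])

lemma lie_algebra_graph_extension: "lie_algebra (graph_extension G)"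
proof (rule lie_algebra_semidirect[OF D.lie_algebra_axioms lie_algebra_F])
  fix s t D assume "s \<in> carrier (Der G)" "t \<in> carrier (Der G)" "D \<in> carrier (F_algebra G)"
  then have st: "s \<in> derivations G" "t \<in> derivations G" "D \<in> F G" by simp_all
  show "F_action G (bracket (Der G) s t) D =
      F_action G s (F_action G t D) - F_action G t (F_action G s D)"
    using st D.bracket_leibniz[of s t D]
    by (simp add: F_action_apply bracket_in_F F_derivation)
qed (auto simp: F_action_derivation F_action_apply F_derivation
    D.bracket_add_left D.bracket_smult_left)


section \<open>Derivations of the full graph\<close>

sublocale graph: lie_algebra "full_graph G"
  by (rule lie_algebra_full_graph)

sublocale ext: lie_algebra "graph_extension G"
  by (rule lie_algebra_graph_extension)

abbreviation "\<iota> \<equiv> graph_embedding G"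

lemma embedding_closed:
  "v \<in> carrier (full_graph G) \<Longrightarrow> \<iota> v \<in> carrier (graph_extension G)"
  by (cases v) (simp add: ad_in_F)

lemma embedding_eq_iff:
  "\<lbrakk>v \<in> carrier (full_graph G); w \<in> carrier (full_graph G)\<rbrakk> \<Longrightarrow> \<iota> v = \<iota> w \<longleftrightarrow> v = w"
  by (cases v; cases w) (simp add: ad_eq_iff)

lemma embedding_add:
  "\<lbrakk>v \<in> carrier (full_graph G); w \<in> carrier (full_graph G)\<rbrakk> \<Longrightarrow> \<iota> (v + w) = \<iota> v + \<iota> w"
  by (cases v; cases w) (simp add: ad_add)

lemma embedding_smult:
  "v \<in> carrier (full_graph G) \<Longrightarrow>
    \<iota> (smult (full_graph G) c v) = smult (graph_extension G) c (\<iota> v)"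
  by (cases v) (simp add: ad_smult)

lemma embedding_diff:
  "\<lbrakk>v \<in> carrier (full_graph G); w \<in> carrier (full_graph G)\<rbrakk> \<Longrightarrow> \<iota> (v - w) = \<iota> v - \<iota> w"
  by (cases v; cases w) (simp add: ad_diff)

text \<open>
  The formula for a graph derivation is the bracket with \<open>u\<close>, seen inside the extension: for
  \<open>u = (s, D)\<close> and \<open>v = (s1, g)\<close> the second component of \<open>[u, \<iota> v]\<close> is
  \<open>[s, ad g] - [s1, D] + [D, ad g] = ad (s g) + [D, s1] + ad (D g)\<close>, and \<open>[D, s1]\<close> is inner. The
  derivation rule and the dependence on \<open>u\<close> follow below by pulling identities of the extension back
  along the injective \<open>\<iota>\<close>.
\<close>

lemma embedding_graph_derivation:
  assumes "u \<in> carrier (graph_extension G)" "v \<in> carrier (full_graph G)"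
  shows "graph_derivation G u v \<in> carrier (full_graph G)"
    and "\<iota> (graph_derivation G u v) = bracket (graph_extension G) u (\<iota> v)"
proof -
  obtain s D s1 g where eq: "u = (s, D)" "v = (s1, g)" by (metis surj_pair)
  have mem: "s \<in> derivations G" "D \<in> F G" "s1 \<in> derivations G" "g \<in> carrier G"
    using assms eq by auto
  note [simp] = mem F_derivation[OF mem(2)] inner_preimage_F[OF mem(2,3)]
    derivationsD(2)[OF mem(1)] derivationsD(2)[OF F_derivation[OF mem(2)]]
  show "graph_derivation G u v \<in> carrier (full_graph G)"
    by (simp add: eq graph_derivation_apply)
  show "\<iota> (graph_derivation G u v) = bracket (graph_extension G) u (\<iota> v)"
    using Der_bracket_skew[of s1 D]
    by (simp add: eq graph_derivation_apply F_action_apply ad_in_F bracket_derivation_ad ad_add)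
qed

text \<open>
  The bracket of the full graph is \<open>s h - t g + [g, h]\<close> in the second component. It goes to the bracket of
  the extension because \<open>[s, ad h] = ad (s h)\<close>, used for \<open>s\<close>, for \<open>t\<close> and for \<open>ad g\<close>.
\<close>

lemma embedding_bracket:
  assumes "v \<in> carrier (full_graph G)" "w \<in> carrier (full_graph G)"
  shows "\<iota> (bracket (full_graph G) v w) = bracket (graph_extension G) (\<iota> v) (\<iota> w)"
proof -
  obtain s g t h where eq: "v = (s, g)" "w = (t, h)" by (metis surj_pair)
  have mem: "s \<in> derivations G" "g \<in> carrier G" "t \<in> derivations G" "h \<in> carrier G"
    using assms eq by auto
  then have "s h \<in> carrier G" "t g \<in> carrier G" by (simp_all add: derivationsD)
  then show ?thesis
    using mem bracket_derivation_ad[OF ad_in_derivations, of g h]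
    by (simp add: eq F_action_apply ad_in_F bracket_derivation_ad ad_add ad_diff)
qed

lemma graph_derivation_in_derivations:
  assumes u: "u \<in> carrier (graph_extension G)"
  shows "graph_derivation G u \<in> derivations (full_graph G)"
proof -
  let ?G = "full_graph G" and ?M = "graph_extension G" and ?d = "graph_derivation G u"
  note d = embedding_graph_derivation[OF u]
  note \<iota> = embedding_add embedding_smult embedding_bracket embedding_closed
  have "?d (v + w) = ?d v + ?d w" if "v \<in> carrier ?G" "w \<in> carrier ?G" for v w
  proof -
    have "\<iota> (?d (v + w)) = \<iota> (?d v + ?d w)"
      using u that d by (simp only: \<iota> graph.carrier_closed ext.bracket_add_right)
    then show ?thesis using that d(1) by (simp only: embedding_eq_iff graph.carrier_closed)
  qed
  moreover have "?d (smult ?G c v) = smult ?G c (?d v)" if "v \<in> carrier ?G" for c v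
  proof -
    have "\<iota> (?d (smult ?G c v)) = \<iota> (smult ?G c (?d v))"
      using u that d by (simp only: \<iota> graph.carrier_closed ext.bracket_smult_right)
    then show ?thesis using that d(1) by (simp only: embedding_eq_iff graph.carrier_closed)
  qed
  moreover have "?d (bracket ?G v w) = bracket ?G (?d v) w + bracket ?G v (?d w)"
    if "v \<in> carrier ?G" "w \<in> carrier ?G" for v w
  proof -
    have "\<iota> (?d (bracket ?G v w)) = \<iota> (bracket ?G (?d v) w + bracket ?G v (?d w))"
      using u that d ext.bracket_leibniz[of u "\<iota> v" "\<iota> w"]
      by (simp only: \<iota> graph.carrier_closed)
    then show ?thesis using that d(1) by (simp only: embedding_eq_iff graph.carrier_closed)
  qed
  ultimately show ?thesis
    using d graph_derivation_outside[of _ G u] unfolding derivations_def by blast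
qed

lemma graph_derivation_add:
  assumes "u \<in> carrier (graph_extension G)" "w \<in> carrier (graph_extension G)"
  shows "graph_derivation G (u + w) = graph_derivation G u + graph_derivation G w"
proof
  fix v
  let ?d = "graph_derivation G"
  show "?d (u + w) v = (?d u + ?d w) v"
  proof (cases "v \<in> carrier (full_graph G)")
    case True
    note d = embedding_graph_derivation[OF _ True]
    have "\<iota> (?d (u + w) v) = \<iota> (?d u v + ?d w v)"
      using assms True d
      by (simp only: embedding_add embedding_closed ext.carrier_closed ext.bracket_add_left)
    then show ?thesis
      using assms True d(1)
      by (simp only: embedding_eq_iff graph.carrier_closed ext.carrier_closed plus_fun_apply)
  qed (simp only: graph_derivation_outside simp_thms plus_fun_apply add_0_right)
qed

lemma graph_derivation_smult:
  assumes "u \<in> carrier (graph_extension G)"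
  shows "graph_derivation G (smult (graph_extension G) c u) =
    smult (Der (full_graph G)) c (graph_derivation G u)"
proof
  fix v
  let ?d = "graph_derivation G"
  show "?d (smult (graph_extension G) c u) v = smult (Der (full_graph G)) c (?d u) v"
  proof (cases "v \<in> carrier (full_graph G)")
    case True
    note d = embedding_graph_derivation[OF _ True]
    have "\<iota> (?d (smult (graph_extension G) c u) v) = \<iota> (smult (full_graph G) c (?d u v))"
      using assms True d
      by (simp only: embedding_smult embedding_closed ext.carrier_closed ext.bracket_smult_left)
    then show ?thesis
      using assms True d(1)
      by (simp only: embedding_eq_iff graph.carrier_closed ext.carrier_closed Der_apply)
  qed (simp only: graph_derivation_outside simp_thms Der_apply graph.scale_zero_right)
qed

lemma graph_derivation_bracket:
  assumes "u \<in> carrier (graph_extension G)" "w \<in> carrier (graph_extension G)"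
  shows "graph_derivation G (bracket (graph_extension G) u w) =
    bracket (Der (full_graph G)) (graph_derivation G u) (graph_derivation G w)"
proof
  fix v
  let ?d = "graph_derivation G"
  show "?d (bracket (graph_extension G) u w) v = bracket (Der (full_graph G)) (?d u) (?d w) v"
  proof (cases "v \<in> carrier (full_graph G)")
    case True
    note d = embedding_graph_derivation
    have "\<iota> (?d (bracket (graph_extension G) u w) v) = \<iota> (?d u (?d w v) - ?d w (?d u v))"
      using assms True d ext.bracket_leibniz[of u w "\<iota> v"]
      by (simp only: embedding_diff embedding_closed ext.carrier_closed add_diff_cancel_right')
    then show ?thesis
      using assms True d(1)
      by (simp only: embedding_eq_iff graph.carrier_closed ext.carrier_closed Der_apply)
  next
    case False
    then show ?thesis
      using assms graph.derivation_zero[OF graph_derivation_in_derivations]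
      by (simp only: graph_derivation_outside simp_thms Der_apply diff_self)
  qed
qed

text \<open>
  A graph derivation shows \<open>s\<close> through its action \<open>ad s\<close> on \<open>Der(G)\<close>, which determines \<open>s\<close> as \<open>Der(G)\<close> is
  centerless; on \<open>G\<close> it acts as \<open>s + D\<close>, which then determines \<open>D\<close>.
\<close>

lemma inj_on_graph_derivation:
  "inj_on (graph_derivation G) (carrier (graph_extension G))"
proof (rule inj_onI)
  fix u w assume "u \<in> carrier (graph_extension G)" "w \<in> carrier (graph_extension G)"
    and eq: "graph_derivation G u = graph_derivation G w"
  then obtain s D t E where uw: "u = (s, D)" "w = (t, E)"
    and mem: "s \<in> derivations G" "D \<in> F G" "t \<in> derivations G" "E \<in> F G" by auto
  have "bracket (Der G) s r = bracket (Der G) t r" if "r \<in> derivations G" for r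
    using fun_cong[OF eq, of "(r, 0)"] that by (simp add: uw graph_derivation_apply)
  then have "ad (Der G) s = ad (Der G) t" by (auto simp: ad_def)
  then have st: "s = t"
    using D.inj_on_ad[OF D.center_trivial] mem by (simp add: inj_on_def)
  have "D g = E g" for g
  proof (cases "g \<in> carrier G")
    case True
    have zero: "inner_preimage G (bracket (Der G) A 0) = 0" if "A \<in> F G" for A
    proof -
      have "bracket (Der G) A 0 = ad G 0"
        using that by (auto simp: fun_eq_iff ad_def F_derivation derivation_zero)
      then show ?thesis by simp
    qed
    show ?thesis
      using fun_cong[OF eq, of "(0, g)"] True mem
      by (simp add: uw st graph_derivation_apply zero)
  qed (use mem in \<open>simp add: derivationsD(1)[OF F_derivation]\<close>)
  then show "u = w" using uw st by auto
qed

text \<open>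
  The derivation rule on the three kinds of brackets, \<open>[s, t]\<close>, \<open>[g, h]\<close> and \<open>[s, g]\<close>, gives one relation
  each between the four blocks of \<open>E\<close>. Completeness of \<open>Der(G)\<close> makes the block from \<open>Der(G)\<close> to itself
  inner, which supplies the first component of the preimage.
\<close>

lemma derivation_of_full_graph_is_graph_derivation:
  assumes E: "E \<in> derivations (full_graph G)"
  shows "\<exists>u\<in>carrier (graph_extension G). E = graph_derivation G u"
proof -
  let ?G = "full_graph G"
  define a where "a s = fst (E (s, 0))" for s
  define b where "b s = snd (E (s, 0))" for s
  define c where "c g = fst (E (0, g))" for g
  define d where "d g = snd (E (0, g))" for g
  have Es: "E (s, 0) = (a s, b s)" and Eg: "E (0, g) = (c g, d g)" for s g
    by (simp_all add: a_def b_def c_def d_def)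
  have ab: "a s \<in> derivations G" "b s \<in> carrier G" if "s \<in> derivations G" for s
    using derivationsD(2)[OF E, of "(s, 0)"] that by (simp_all add: Es)
  have cd: "c g \<in> derivations G" "d g \<in> carrier G" if "g \<in> carrier G" for g
    using derivationsD(2)[OF E, of "(0, g)"] that by (simp_all add: Eg)
  have ss: "a (bracket (Der G) s t) = bracket (Der G) (a s) t + bracket (Der G) s (a t)"
    if "s \<in> derivations G" "t \<in> derivations G" for s t
    using derivationsD(5)[OF E, of "(s, 0)" "(t, 0)"] that ab
    by (simp add: Es derivation_zero)
  have gg: "c (bracket G g h) = 0"
    "d (bracket G g h) = c g h - c h g + bracket G (d g) h + bracket G g (d h)"
    if "g \<in> carrier G" "h \<in> carrier G" for g h
    using derivationsD(5)[OF E, of "(0, g)" "(0, h)"] that cd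
      D.bracket_zero[of "c g"] D.bracket_zero[of "c h"] D.bracket_zero[of 0]
    by (simp_all add: Eg derivation_zero)
  have sg: "c (s g) = bracket (Der G) s (c g)" "d (s g) = a s g + bracket G (b s) g + s (d g)"
    if "s \<in> derivations G" "g \<in> carrier G" for s g
    using derivationsD(5)[OF E, of "(s, 0)" "(0, g)"] that ab cd
      D.bracket_zero[of "a s"] D.bracket_zero[of s]
    by (simp_all add: Eg Es derivation_zero)
  (* The inner case of the relation between s and g gives [ad h, c g] = c [h, g], which vanishes by
     the relation between g and h. Thus ad (c g h) = 0, and centerlessness applies. *)
  have c0: "c g = 0" if g: "g \<in> carrier G" for g
  proof
    fix h
    show "c g h = 0 h"
    proof (cases "h \<in> carrier G")
      case True
      have "ad G (c g h) = bracket (Der G) (c g) (ad G h)"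
        using True g cd by (simp add: bracket_derivation_ad)
      also have "\<dots> = - bracket (Der G) (ad G h) (c g)"
        using True g cd by (intro Der_bracket_skew ad_in_derivations)
      also have "bracket (Der G) (ad G h) (c g) = c (bracket G h g)"
        using sg(1)[of "ad G h" g] True g by (simp add: ad_in_derivations)
      also have "\<dots> = 0" using gg(1) True g by simp
      finally have "ad G (c g h) = ad G 0" by (auto simp: fun_eq_iff ad_def)
      then show ?thesis using True g cd by (simp add: ad_eq_iff derivationsD)
    qed (use cd[OF g] in \<open>simp add: derivationsD\<close>)
  qed
  have "a \<in> derivations (Der G)"
    unfolding derivations_def
  proof (intro CollectI conjI ballI allI impI)
    fix s assume "s \<notin> carrier (Der G)"
    then show "a s = 0" using derivationsD(1)[OF E, of "(s, 0)"] by (simp add: a_def)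
  next
    fix s t assume "s \<in> carrier (Der G)" "t \<in> carrier (Der G)"
    then show "a (s + t) = a s + a t"
      using derivationsD(3)[OF E, of "(s, 0)" "(t, 0)"] by (simp add: a_def)
  next
    fix k s assume "s \<in> carrier (Der G)"
    then show "a (smult (Der G) k s) = smult (Der G) k (a s)"
      using derivationsD(4)[OF E, of "(s, 0)" k] by (simp add: Es)
  qed (use ab ss in simp_all)
  then obtain s0 where s0: "s0 \<in> derivations G" and a: "a = ad (Der G) s0"
    using D.derivations_inner by auto
  have d: "d \<in> derivations G"
    unfolding derivations_def
  proof (intro CollectI conjI ballI allI impI)
    fix g assume "g \<notin> carrier G"
    then show "d g = 0" using derivationsD(1)[OF E, of "(0, g)"] by (simp add: d_def)
  next
    fix g h assume "g \<in> carrier G" "h \<in> carrier G"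
    then show "d (g + h) = d g + d h"
      using derivationsD(3)[OF E, of "(0, g)" "(0, h)"] by (simp add: d_def)
  next
    fix k g assume "g \<in> carrier G"
    then show "d (smult G k g) = smult G k (d g)"
      using derivationsD(4)[OF E, of "(0, g)" k] by (simp add: Eg)
  qed (use cd gg c0 in simp_all)
  (* A graph derivation (s0, D) acts on G as s0 + D, so this is the only possible choice. *)
  define D where "D = d - s0"
  have D: "D \<in> derivations G" using d s0 by (simp add: D_def)
  have Db: "bracket (Der G) D s = ad G (b s)" if s: "s \<in> derivations G" for s
  proof
    fix g
    show "bracket (Der G) D s g = ad G (b s) g"
    proof (cases "g \<in> carrier G")
      case True
      have "s (d g) = s (d g - s0 g) + s (s0 g)"
        using True s s0 cd by (simp add: derivation_diff derivationsD)
      then show ?thesis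
        using True s sg(2)[OF s True] by (simp add: D_def a algebra_simps)
    qed (use s D in \<open>simp add: ad_def derivationsD derivation_zero\<close>)
  qed
  have DF: "D \<in> F G" using D Db ab by (simp add: F_def)
  have "E v = graph_derivation G (s0, D) v" for v
  proof (cases "v \<in> carrier ?G")
    case True
    obtain s g where v: "v = (s, g)" "s \<in> derivations G" "g \<in> carrier G"
      using True by auto
    have "E v = E (s, 0) + E (0, g)"
      using derivationsD(3)[OF E, of "(s, 0)" "(0, g)"] v by simp
    moreover have "d g = s0 g + D g" by (simp add: D_def)
    then have "E (s, 0) + E (0, g) = graph_derivation G (s0, D) v"
      using v by (simp add: Es Eg c0 graph_derivation_apply Db ab a)
    ultimately show ?thesis by simp
  qed (simp only: derivationsD(1)[OF E] graph_derivation_outside simp_thms)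
  moreover have "(s0, D) \<in> carrier (graph_extension G)" using s0 DF by simp
  ultimately show ?thesis by blast
qed

lemma graph_derivation_isomorphism:
  "lie_isomorphism (graph_extension G) (Der (full_graph G)) (graph_derivation G)"
proof (rule ext.isomorphism_onto_image)
  show "vector_space (smult (Der (full_graph G)))"
    by unfold_locales
      (simp_all only: fun_eq_iff Der_apply plus_fun_apply graph.scale_right_distrib
        graph.scale_left_distrib graph.scale_scale graph.scale_one simp_thms)
  show "bij_betw (graph_derivation G) (carrier (graph_extension G)) (carrier (Der (full_graph G)))"
    unfolding bij_betw_def carrier_Der
    using inj_on_graph_derivation graph_derivation_in_derivations
      derivation_of_full_graph_is_graph_derivation by blast
qed (fact graph_derivation_add graph_derivation_smult graph_derivation_bracket)+


section \<open>Completeness of the full graph\<close>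

text \<open>
  Bracketing with \<open>Der(G)\<close> puts the first component into the center of \<open>Der(G)\<close>, and bracketing with
  \<open>G\<close> then puts the second into the center of \<open>G\<close>.
\<close>

lemma center_full_graph: "center (full_graph G) = {0}"
proof (intro equalityI subsetI)
  fix v assume v: "v \<in> center (full_graph G)"
  then obtain s x where eq: "v = (s, x)" and mem: "s \<in> derivations G" "x \<in> carrier G"
    by (auto simp: center_def)
  have v0: "bracket (full_graph G) (s, x) w = 0" if "w \<in> carrier (full_graph G)" for w
    using v that unfolding center_def eq by blast
  have "bracket (Der G) s t = 0" if "t \<in> derivations G" for t
    using v0[of "(t, 0)"] that by (simp add: zero_prod_def)
  then have "s \<in> center (Der G)" using mem by (simp add: center_def)
  then have s: "s = 0" using D.center_trivial by simp
  have "bracket G x g = 0" if "g \<in> carrier G" for g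
    using v0[of "(0, g)"] that mem by (simp add: zero_prod_def s)
  then have "x \<in> center G" using mem by (simp add: center_def)
  then show "v \<in> {0}" using centerless s by (simp add: eq zero_prod_def)
next
  fix v :: "('a \<Rightarrow> 'a) \<times> 'a" assume "v \<in> {0}"
  then show "v \<in> center (full_graph G)"
    using graph.carrier_closed(1) graph.bracket_zero(1) by (simp only: center_def) blast
qed

text \<open>
  Both sides become the bracket with \<open>\<iota> v\<close> after applying \<open>\<iota>\<close>, so inner derivations are the graph
  derivations of elements of the embedded full graph.
\<close>

lemma ad_full_graph:
  assumes "v \<in> carrier (full_graph G)"
  shows "ad (full_graph G) v = graph_derivation G (\<iota> v)"
proof
  fix w
  show "ad (full_graph G) v w = graph_derivation G (\<iota> v) w"
  proof (cases "w \<in> carrier (full_graph G)")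
    case True
    note closed = graph.carrier_closed(6)[OF assms True]
      embedding_graph_derivation(1)[OF embedding_closed[OF assms] True]
    have "\<iota> (bracket (full_graph G) v w) = \<iota> (graph_derivation G (\<iota> v) w)"
      using assms True
      by (simp only: embedding_bracket embedding_graph_derivation embedding_closed)
    then show ?thesis
      by (simp only: embedding_eq_iff[OF closed] graph.ad_apply[OF True])
  qed (simp only: ad_def graph_derivation_outside if_False simp_thms)
qed

lemma complete_full_graph_iff:
  "complete_lie_algebra (full_graph G) \<longleftrightarrow> F G = ad G ` carrier G"
proof
  assume complete: "complete_lie_algebra (full_graph G)"
  have "D \<in> ad G ` carrier G" if D: "D \<in> F G" for D
  proof -
    have u: "(0, D) \<in> carrier (graph_extension G)" using D by simp
    obtain v where v: "v \<in> carrier (full_graph G)"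
      and "graph_derivation G (0, D) = ad (full_graph G) v"
      using complete_lie_algebra.derivations_inner[OF complete graph_derivation_in_derivations[OF u]]
      by blast
    then have "(0, D) = \<iota> v"
      using inj_onD[OF inj_on_graph_derivation _ u embedding_closed[OF v]] ad_full_graph[OF v]
      by simp
    then show ?thesis using v by (cases v) auto
  qed
  then show "F G = ad G ` carrier G" using ad_in_F by blast
next
  assume inner: "F G = ad G ` carrier G"
  show "complete_lie_algebra (full_graph G)"
  proof (intro complete_lie_algebra.intro complete_lie_algebra_axioms.intro
      graph.lie_algebra_axioms center_full_graph)
    fix E assume "E \<in> derivations (full_graph G)"
    then obtain u where u: "u \<in> carrier (graph_extension G)" "E = graph_derivation G u"
      using derivation_of_full_graph_is_graph_derivation by blast
    obtain s D where sD: "u = (s, D)" by (metis surj_pair)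
    then obtain x where x: "x \<in> carrier G" "D = ad G x" using u inner by auto
    then have v: "(s, x) \<in> carrier (full_graph G)" using u sD by simp
    have "E = ad (full_graph G) (s, x)"
      using u sD x by (simp add: ad_full_graph[OF v])
    then show "\<exists>v\<in>carrier (full_graph G). E = ad (full_graph G) v"
      using v by blast
  qed
qed

end

theorem theorem2:
  fixes G :: "('k::field_char_0, 'a::ab_group_add) lie_structure"
  assumes "lie_algebra G"
    and "center G = {0}"
    and "complete_lie_algebra (Der G)"
  shows "lie_isomorphism (semidirect (Der G) (F_action G) (F_algebra G)) (Der (full_graph G))
           (graph_derivation G)
         \<and> (complete_lie_algebra (full_graph G) \<longleftrightarrow> F G = ad G ` carrier G)"
proof -
  interpret centerless_lie_algebra_with_complete_Der G
    using assms by (intro centerless_lie_algebra_with_complete_Der.intro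
        centerless_lie_algebra_with_complete_Der_axioms.intro)
  show ?thesis using graph_derivation_isomorphism complete_full_graph_iff by blast
qed

end
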